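(* Let $u,v,w\ge0$ be integers and $L=u+v+w$. Consider walks on $\mathbb Z^3$ starting at $(u,v,w)$ with steps in $\Omega_2=\Omega_2'\cup\Omega_2''$, where $\Omega_2'=\{(1,0,-1),(-1,1,0),(0,-1,1)\}$ and $\Omega_2''=\{(1,-1,0),(-1,0,1),(0,1,-1)\}$, that stay in the non-negative orthant $(\mathbb N_0)^3$ (so they stay on the triangular domain $\{(n_x,n_y,n_z)\in(\mathbb N_0)^3:n_x+n_y+n_z=L\}$). Give each step in $\Omega_2'$ weight $\alpha$ and each step in $\Omega_2''$ weight $\beta$, and let $$G(t)=\sum_{\text{walks }\omega}\alpha^{\#\{\text{steps of }\omega\text{ in }\Omega_2'\}}\beta^{\#\{\text{steps of }\omega\text{ in }\Omega_2''\}}t^{|\omega|},$$ the sum over all such walks (of any length $|\omega|\ge0$, with arbitrary endpoint). Then $$G(t)=\frac{(1-p^3)(1-p^{u+1})(1-p^{v+1})(1-p^{w+1})}{(1-p)^3(1-p^{u+v+w+3})},$$ where $p=(\alpha+\beta)t\,M((\alpha+\beta)t)$ and $M(s)=\dfrac{1-s-\sqrt{(1+s)(1-3s)}}{2s^2}$ is the generating function of Motzkin paths.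
   Context: $\alpha,\beta$ are indeterminates (weights); the identity is one of formal power series in $t$. The series $p$ has zero constant term and satisfies $1=(\alpha+\beta)t(p+1+1/p)$. *)

theory Defs
  imports
    "HOL-Computational_Algebra.Formal_Power_Series"
    "HOL-Library.Product_Plus"
begin

definition Omega2' :: "(int \<times> int \<times> int) set" where
  "Omega2' = {(1, 0, -1), (-1, 1, 0), (0, -1, 1)}"

definition Omega2'' :: "(int \<times> int \<times> int) set" where
  "Omega2'' = {(1, -1, 0), (-1, 0, 1), (0, 1, -1)}"

definition Omega2 :: "(int \<times> int \<times> int) set" where
  "Omega2 = Omega2' \<union> Omega2''"

definition orthant :: "(int \<times> int \<times> int) set" where
  "orthant = {(x, y, z). 0 \<le> x \<and> 0 \<le> y \<and> 0 \<le> z}"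

text \<open>A walk is the list of its steps; the point reached after \<open>k\<close> steps is
  \<open>P + sum_list (take k \<omega>)\<close>.\<close>

definition orthant_walks :: "int \<times> int \<times> int \<Rightarrow> nat \<Rightarrow> (int \<times> int \<times> int) list set" where
  "orthant_walks P n =
     {\<omega>. length \<omega> = n \<and> set \<omega> \<subseteq> Omega2 \<and> (\<forall>k\<le>n. P + sum_list (take k \<omega>) \<in> orthant)}"

lemma finite_orthant_walks: "finite (orthant_walks P n)"
proof (rule finite_subset)
  show "orthant_walks P n \<subseteq> {\<omega>. set \<omega> \<subseteq> Omega2 \<and> length \<omega> = n}"
    by (auto simp: orthant_walks_def)
  show "finite {\<omega>. set \<omega> \<subseteq> Omega2 \<and> length \<omega> = n}"
    by (rule finite_lists_length_eq) (simp add: Omega2_def Omega2'_def Omega2''_def)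
qed

definition walk_gf :: "'a::comm_semiring_1 \<Rightarrow> 'a \<Rightarrow> int \<times> int \<times> int \<Rightarrow> 'a fps" where
  "walk_gf \<alpha> \<beta> P = Abs_fps (\<lambda>n. \<Sum>\<omega>\<in>orthant_walks P n.
     \<alpha> ^ length (filter (\<lambda>s. s \<in> Omega2') \<omega>) * \<beta> ^ length (filter (\<lambda>s. s \<in> Omega2'') \<omega>))"

definition motzkin_paths :: "nat \<Rightarrow> int list set" where
  "motzkin_paths n =
     {\<omega>. length \<omega> = n \<and> set \<omega> \<subseteq> {-1, 0, 1} \<and> (\<forall>k\<le>n. 0 \<le> sum_list (take k \<omega>)) \<and> sum_list \<omega> = 0}"

lemma finite_motzkin_paths: "finite (motzkin_paths n)"
proof (rule finite_subset)
  show "motzkin_paths n \<subseteq> {\<omega>. set \<omega> \<subseteq> {-1, 0, 1} \<and> length \<omega> = n}"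
    by (auto simp: motzkin_paths_def)
  show "finite {\<omega>. set \<omega> \<subseteq> {-1, 0, 1 :: int} \<and> length \<omega> = n}"
    by (rule finite_lists_length_eq) simp
qed

definition motzkin_gf :: "'a::semiring_1 fps" where
  "motzkin_gf = Abs_fps (\<lambda>n. of_nat (card (motzkin_paths n)))"

text \<open>The first argument of \<^const>\<open>fps_radical\<close> selects the root of the constant coefficient:
  here the square root is the one with constant coefficient 1, so that the numerator is divisible
  by \<open>fps_X\<^sup>2\<close> and the division is exact.\<close>

definition motzkin_series :: "'a::field_char_0 fps" where
  "motzkin_series =
     (1 - fps_X - fps_radical (\<lambda>_ _. 1) 2 ((1 + fps_X) * (1 - 3 * fps_X))) / (2 * fps_X ^ 2)"

end

theory Submission
  imports Defs
begin

text \<open>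
  Splitting off the first step gives a recurrence in the starting point that determines the
  generating functions of confined walks, so it suffices to check that the claimed closed forms
  satisfy it. For the triangular walks write \<open>x = p\<^bsup>u+1\<^esup>\<close>, \<open>y = p\<^bsup>v+1\<^esup>\<close>,
  \<open>z = p\<^bsup>w+1\<^esup>\<close>. Then \<open>(1 - x) (1 - y) (1 - z) = (1 - x y z) - (x + y + z) + (x y + y z + z x)\<close>
  vanishes as soon as the walk leaves the orthant, and \<open>x y z\<close> is constant along walks. The sum over
  the three steps of \<open>\<Omega>\<^sub>2'\<close>, and likewise of \<open>\<Omega>\<^sub>2''\<close>, multiplies the last two
  symmetric functions by \<open>p + 1 + 1/p\<close>, which is \<open>1/((\<alpha> + \<beta>) t)\<close>. Similarly the Motzkin paths that
  start at height \<open>h\<close> have generating function \<open>M (t M)\<^bsup>h\<^esup>\<close>.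
\<close>

unbundle fps_syntax

section \<open>Weighted confined walks\<close>

text \<open>Covers both uses: Motzkin paths live on the integers and end at 0, triangular walks live
  on triples and end anywhere (\<open>E = UNIV\<close>).\<close>

definition confined_walks ::
    "'b::comm_monoid_add set \<Rightarrow> 'b set \<Rightarrow> 'b set \<Rightarrow> 'b \<Rightarrow> nat \<Rightarrow> 'b list set" where
  "confined_walks S A E P n =
     {\<omega>. length \<omega> = n \<and> set \<omega> \<subseteq> S \<and> (\<forall>k\<le>n. P + sum_list (take k \<omega>) \<in> A) \<and> P + sum_list \<omega> \<in> E}"

definition walk_weight ::
    "('b \<Rightarrow> 'a::comm_semiring_1) \<Rightarrow> 'b::comm_monoid_add set \<Rightarrow> 'b set \<Rightarrow> 'b set \<Rightarrow> 'b \<Rightarrow> nat \<Rightarrow> 'a" where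
  "walk_weight wt S A E P n = (\<Sum>\<omega>\<in>confined_walks S A E P n. prod_list (map wt \<omega>))"

lemma finite_confined_walks:
  assumes "finite S"
  shows "finite (confined_walks S A E P n)"
  by (rule finite_subset[OF _ finite_lists_length_eq[OF assms, of n]])
    (auto simp: confined_walks_def)

lemma confined_walks_outside: "P \<notin> A \<Longrightarrow> confined_walks S A E P n = {}"
  by (force simp: confined_walks_def)

lemma confined_walks_0: "P \<in> A \<Longrightarrow> confined_walks S A E P 0 = (if P \<in> E then {[]} else {})"
  by (auto simp: confined_walks_def)

lemma confined_walks_Suc:
  assumes "P \<in> A"
  shows "confined_walks S A E P (Suc n) = (\<Union>s\<in>S. (#) s ` confined_walks S A E (P + s) n)"
proof (intro set_eqI iffI)
  fix \<omega>
  assume \<omega>: "\<omega> \<in> confined_walks S A E P (Suc n)"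
  then obtain s \<omega>' where [simp]: "\<omega> = s # \<omega>'"
    by (cases \<omega>) (auto simp: confined_walks_def)
  have "P + s + sum_list (take k \<omega>') \<in> A" if "k \<le> n" for k
  proof -
    from \<omega> that have "P + sum_list (take (Suc k) \<omega>) \<in> A"
      unfolding confined_walks_def by blast
    then show ?thesis by (simp add: add.assoc)
  qed
  with \<omega> show "\<omega> \<in> (\<Union>s\<in>S. (#) s ` confined_walks S A E (P + s) n)"
    by (auto simp: confined_walks_def add.assoc)
next
  fix \<omega>
  assume "\<omega> \<in> (\<Union>s\<in>S. (#) s ` confined_walks S A E (P + s) n)"
  then obtain s \<omega>' where s: "s \<in> S" "\<omega>' \<in> confined_walks S A E (P + s) n"
    and [simp]: "\<omega> = s # \<omega>'"
    by auto
  have "P + sum_list (take k \<omega>) \<in> A" if "k \<le> Suc n" for k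
    using that s assms by (cases k) (auto simp: confined_walks_def add.assoc)
  with s show "\<omega> \<in> confined_walks S A E P (Suc n)"
    by (auto simp: confined_walks_def add.assoc)
qed

lemma walk_weight_outside: "P \<notin> A \<Longrightarrow> walk_weight wt S A E P n = 0"
  by (simp add: walk_weight_def confined_walks_outside)

lemma walk_weight_0: "P \<in> A \<Longrightarrow> walk_weight wt S A E P 0 = (if P \<in> E then 1 else 0)"
  by (simp add: walk_weight_def confined_walks_0)

lemma walk_weight_Suc:
  assumes "finite S" and "P \<in> A"
  shows "walk_weight wt S A E P (Suc n) = (\<Sum>s\<in>S. wt s * walk_weight wt S A E (P + s) n)"
proof -
  have "walk_weight wt S A E P (Suc n) =
      (\<Sum>s\<in>S. \<Sum>\<omega>\<in>(#) s ` confined_walks S A E (P + s) n. prod_list (map wt \<omega>))"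
    unfolding walk_weight_def confined_walks_Suc[OF assms(2)]
    using assms(1) by (subst sum.UNION_disjoint) (auto simp: finite_confined_walks)
  then show ?thesis
    by (simp add: walk_weight_def sum.reindex sum_distrib_left)
qed

section \<open>Motzkin paths\<close>

lemma motzkin_series_functional_eq:
  "(motzkin_series :: 'a::field_char_0 fps) =
     1 + fps_X * motzkin_series + fps_X\<^sup>2 * motzkin_series\<^sup>2"
proof -
  define R :: "'a fps" where "R = fps_radical (\<lambda>_ _. 1) 2 ((1 + fps_X) * (1 - 3 * fps_X))"
  define M :: "'a fps" where "M = motzkin_series"
  have R_square: "R\<^sup>2 = (1 + fps_X) * (1 - 3 * fps_X)"
    unfolding R_def numeral_2_eq_2
    by (subst power_radical[symmetric]) (auto simp: fps_mult_nth_0)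
  have R0: "R $ 0 = 1"
    by (simp add: R_def)
  \<comment> \<open>The first two coefficients of \<open>R\<close> agree with those of
    \<open>1 - fps_X\<close>, which makes the numerator divisible by
    \<open>2 * fps_X\<^sup>2\<close> and the defining quotient exact.\<close>
  have "(R\<^sup>2) $ 1 = - 2"
    by (simp add: R_square algebra_simps fps_X_def numeral_fps_const)
  then have R1: "R $ 1 = - 1"
    using R0 by (simp add: power2_eq_square fps_mult_nth_1)
  have "1 - fps_X - R = 2 * fps_X\<^sup>2 * (fps_const (1 / 2) * fps_shift 2 (1 - fps_X - R))"
  proof (rule fps_ext)
    fix n :: nat
    have "n = 0 \<or> n = 1 \<or> (\<exists>m. n = m + 2)"
      by presburger
    then show "(1 - fps_X - R) $ n =
        (2 * fps_X\<^sup>2 * (fps_const (1 / 2) * fps_shift 2 (1 - fps_X - R))) $ n"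
      using R0 R1
      by (auto simp: numeral_fps_const fps_X_power_mult_nth mult.assoc fps_mult_left_const_nth)
  qed
  then have "2 * fps_X\<^sup>2 dvd 1 - fps_X - R"
    by (rule dvdI)
  then have M: "2 * fps_X\<^sup>2 * M = 1 - fps_X - R"
    unfolding M_def motzkin_series_def R_def[symmetric] by simp
  have "(1 - fps_X - 2 * fps_X\<^sup>2 * M)\<^sup>2 = (1 + fps_X) * (1 - 3 * fps_X)"
    unfolding M using R_square by simp
  \<comment> \<open>Completing the square in the quadratic equation for \<open>M\<close>.\<close>
  moreover have "(4 * fps_X\<^sup>2) * (1 + fps_X * M + fps_X\<^sup>2 * M\<^sup>2) - (4 * fps_X\<^sup>2) * M =
      (1 - fps_X - 2 * fps_X\<^sup>2 * M)\<^sup>2 - (1 + fps_X) * (1 - 3 * fps_X)"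
    by (simp add: algebra_simps power2_eq_square)
  ultimately have "(4 * fps_X\<^sup>2) * M = (4 * fps_X\<^sup>2) * (1 + fps_X * M + fps_X\<^sup>2 * M\<^sup>2)"
    by simp
  then show ?thesis
    unfolding M_def[symmetric] by simp
qed

abbreviation motzkin_weight :: "nat \<Rightarrow> nat \<Rightarrow> 'a::comm_semiring_1" where
  "motzkin_weight h \<equiv> walk_weight (\<lambda>_. 1) {-1, 0, 1} {0..} {0} (int h)"

text \<open>The height is generalised because the first step changes it. For \<open>h > 0\<close>,
  expanding one factor \<open>M\<close> by its equation produces the three possible first steps. For
  \<open>h = 0\<close> the equation itself does so, as the down step leaves the half-line and counts
  0.\<close>

lemma motzkin_weight_eq_coeff:
  fixes M :: "'a::comm_ring_1 fps"
  assumes M: "M = 1 + fps_X * M + fps_X\<^sup>2 * M\<^sup>2"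
  shows "motzkin_weight h n = (M * (fps_X * M) ^ h) $ n"
proof (induction n arbitrary: h)
  case 0
  have "M $ 0 = 1"
    by (subst M) simp
  then show ?case
    by (cases h) (simp_all add: walk_weight_0 fps_mult_nth_0)
next
  case (Suc n)
  show ?case
  proof (cases h)
    case 0
    have "M = 1 + fps_X * (M + M * (fps_X * M))"
      by (subst M) (simp add: algebra_simps power2_eq_square)
    from arg_cong[OF this, of "\<lambda>f. f $ Suc n"] show ?thesis
      using 0 Suc.IH[of 0] Suc.IH[of 1]
      by (simp add: walk_weight_Suc walk_weight_outside)
  next
    case (Suc h')
    have "fps_X * (M * (fps_X * M) ^ h' + M * (fps_X * M) ^ h + M * (fps_X * M) ^ Suc h) =
        fps_X * (M * (fps_X * M) ^ h') * (1 + fps_X * M + fps_X\<^sup>2 * M\<^sup>2)"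
      by (simp add: Suc algebra_simps power2_eq_square)
    also have "\<dots> = M * (fps_X * M) ^ h"
      by (simp add: Suc mult_ac flip: M)
    finally have "M * (fps_X * M) ^ h =
        fps_X * (M * (fps_X * M) ^ h' + M * (fps_X * M) ^ h + M * (fps_X * M) ^ Suc h)" ..
    from arg_cong[OF this, of "\<lambda>f. f $ Suc n"] show ?thesis
      using Suc.IH[of h'] Suc.IH[of h] Suc.IH[of "Suc h"] Suc
      by (simp add: walk_weight_Suc add.commute add.left_commute)
  qed
qed

lemma motzkin_series_eq_gf: "(motzkin_series :: 'a::field_char_0 fps) = motzkin_gf"
proof (rule fps_ext)
  fix n
  have "motzkin_paths n = confined_walks {-1, 0, 1} {0..} {0} 0 n"
    by (auto simp: motzkin_paths_def confined_walks_def)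
  then have "motzkin_gf $ n = (motzkin_weight 0 n :: 'a)"
    by (simp add: motzkin_gf_def walk_weight_def map_replicate_const)
  then show "(motzkin_series :: 'a fps) $ n = motzkin_gf $ n"
    using motzkin_weight_eq_coeff[OF motzkin_series_functional_eq[where 'a = 'a], of 0 n] by simp
qed

section \<open>Walks on the triangular domain\<close>

definition triangle_step_weight :: "'a \<Rightarrow> 'a \<Rightarrow> int \<times> int \<times> int \<Rightarrow> 'a::comm_semiring_1" where
  "triangle_step_weight \<alpha> \<beta> s = (if s \<in> Omega2' then \<alpha> else \<beta>)"

lemma finite_Omega2: "finite Omega2"
  by (simp add: Omega2_def Omega2'_def Omega2''_def)

lemma prod_list_triangle_step_weight:
  "set \<omega> \<subseteq> Omega2 \<Longrightarrow> prod_list (map (triangle_step_weight \<alpha> \<beta>) \<omega>) =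
     \<alpha> ^ length (filter (\<lambda>s. s \<in> Omega2') \<omega>) * \<beta> ^ length (filter (\<lambda>s. s \<in> Omega2'') \<omega>)"
proof (induction \<omega>)
  case (Cons s \<omega>)
  have "Omega2' \<inter> Omega2'' = {}"
    by (simp add: Omega2'_def Omega2''_def)
  then have "s \<in> Omega2'' \<longleftrightarrow> s \<notin> Omega2'"
    using Cons.prems by (auto simp: Omega2_def)
  moreover have "set \<omega> \<subseteq> Omega2"
    using Cons.prems by simp
  ultimately show ?case
    by (cases "s \<in> Omega2'") (simp_all add: Cons.IH triangle_step_weight_def[of _ _ s] mult_ac)
qed simp

lemma walk_gf_nth:
  "walk_gf \<alpha> \<beta> P $ n = walk_weight (triangle_step_weight \<alpha> \<beta>) Omega2 orthant UNIV P n"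
proof -
  have "orthant_walks P n = confined_walks Omega2 orthant UNIV P n"
    by (auto simp: orthant_walks_def confined_walks_def)
  then show ?thesis
    unfolding walk_gf_def walk_weight_def
    by (auto simp: confined_walks_def prod_list_triangle_step_weight intro!: sum.cong)
qed

lemma sum_Omega2_triangle_step_weight:
  "(\<Sum>s\<in>Omega2. triangle_step_weight \<alpha> \<beta> s * f s) =
     \<alpha> * (f (1, 0, -1) + f (-1, 1, 0) + f (0, -1, 1)) +
     \<beta> * (f (1, -1, 0) + f (-1, 0, 1) + f (0, 1, -1))"
  by (simp add: Omega2_def Omega2'_def Omega2''_def triangle_step_weight_def algebra_simps)

text \<open>The exponents are the coordinates plus one. A step out of the orthant makes a coordinate
  -1, hence an exponent 0, so natural exponents suffice and the product vanishes there.\<close>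

definition triangle_product :: "'a::comm_ring_1 \<Rightarrow> nat \<Rightarrow> nat \<Rightarrow> nat \<Rightarrow> 'a" where
  "triangle_product p a b c = (1 - p ^ a) * (1 - p ^ b) * (1 - p ^ c)"

text \<open>Multiplied by \<open>s\<close> so that no negative power of \<open>p\<close> occurs; \<open>p\<close> may vanish.\<close>

lemma triangle_product_cyclic_step:
  fixes p s :: "'a::comm_ring_1"
  assumes "s * (1 + p + p\<^sup>2) = p"
  shows "s * (triangle_product p (a + 2) (b + 1) c + triangle_product p a (b + 2) (c + 1) +
              triangle_product p (a + 1) b (c + 2)) =
         triangle_product p (a + 1) (b + 1) (c + 1) - (1 - 3 * s) * (1 - p ^ (a + b + c + 3))"
proof -
  define x y z where "x = p ^ a" and "y = p ^ b" and "z = p ^ c"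
  note defs = triangle_product_def power_add x_def[symmetric] y_def[symmetric] z_def[symmetric]
  have "s * (triangle_product p (a + 2) (b + 1) c + triangle_product p a (b + 2) (c + 1) +
          triangle_product p (a + 1) b (c + 2)) =
      s * (1 + p + p\<^sup>2) * (p * (x * y + y * z + z * x) - (x + y + z)) +
      3 * s * (1 - p ^ 3 * x * y * z)"
    unfolding defs by (simp add: algebra_simps power2_eq_square power3_eq_cube)
  \<comment> \<open>The first summand turns into the non-constant part of the product at the centre.
    The constant part \<open>1 - p ^ 3 * x * y * z\<close> comes with the factor
    \<open>3 * s\<close> instead of 1, which leaves the defect.\<close>
  also have "\<dots> = triangle_product p (a + 1) (b + 1) (c + 1) -
      (1 - 3 * s) * (1 - p ^ (a + b + c + 3))"
    unfolding assms defs by (simp add: algebra_simps power3_eq_cube)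
  finally show ?thesis .
qed

text \<open>In both sums each exponent is raised by 0, 1 and 2 once, each pair of exponents by 1, 2
  and 3 in total, and all three together always by 3. Hence the weights enter only through
  \<open>\<alpha> + \<beta>\<close>.\<close>

lemma triangle_product_reverse_step:
  "triangle_product p (a + 2) b (c + 1) + triangle_product p a (b + 1) (c + 2) +
     triangle_product p (a + 1) (b + 2) c =
   triangle_product p (a + 2) (b + 1) c + triangle_product p a (b + 2) (c + 1) +
     triangle_product p (a + 1) b (c + 2)"
  by (simp add: triangle_product_def algebra_simps power2_eq_square)

text \<open>The defect of the cyclic step depends only on \<open>K\<close>, which is constant along
  walks, so a single factor \<open>C\<close> normalises it to 1, the contribution of the empty
  walk.\<close>

lemma walk_gf_nth_eq_triangle_product:
  fixes \<alpha> \<beta> :: "'a::comm_ring_1" and p C :: "'a fps"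
  defines "s \<equiv> fps_const (\<alpha> + \<beta>) * fps_X"
  assumes p: "s * (1 + p + p\<^sup>2) = p"
    and C: "C * ((1 - 3 * s) * (1 - p ^ K)) = 1"
    and "a + b + c = K"
  shows "walk_gf \<alpha> \<beta> (int a - 1, int b - 1, int c - 1) $ n = (C * triangle_product p a b c) $ n"
  using \<open>a + b + c = K\<close>
proof (induction n arbitrary: a b c rule: less_induct)
  case (less n)
  show ?case
  proof (cases "a = 0 \<or> b = 0 \<or> c = 0")
    case True
    then show ?thesis
      by (auto simp: walk_gf_nth walk_weight_outside orthant_def triangle_product_def)
  next
    case False
    then obtain i j k where abc: "a = i + 1" "b = j + 1" "c = k + 1"
      by (metis Suc_eq_plus1 not0_implies_Suc)
    have K: "K = i + j + k + 3"
      using less.prems abc by simp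
    have inside: "(int a - 1, int b - 1, int c - 1) \<in> orthant"
      by (simp add: abc orthant_def)
    define T where "T x y z = C * triangle_product p x y z" for x y z
    have "s * (T (i + 2) (j + 1) k + T i (j + 2) (k + 1) + T (i + 1) j (k + 2)) =
        C * (s * (triangle_product p (i + 2) (j + 1) k + triangle_product p i (j + 2) (k + 1) +
          triangle_product p (i + 1) j (k + 2)))"
      by (simp add: T_def distrib_left mult.left_commute)
    also have "\<dots> = T a b c - 1"
      using C by (simp only: triangle_product_cyclic_step[OF p]
          right_diff_distrib[of C "triangle_product _ _ _ _"] T_def abc K)
    finally have sum_eq:
      "s * (T (i + 2) (j + 1) k + T i (j + 2) (k + 1) + T (i + 1) j (k + 2)) = T a b c - 1" .
    have "T (i + 2) j (k + 1) + T i (j + 1) (k + 2) + T (i + 1) (j + 2) k =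
        T (i + 2) (j + 1) k + T i (j + 2) (k + 1) + T (i + 1) j (k + 2)"
      unfolding T_def distrib_left[symmetric] triangle_product_reverse_step ..
    \<comment> \<open>The first-step recurrence: as both sums agree, \<open>s\<close> times one of
      them splits into an \<open>\<alpha>\<close> part and a \<open>\<beta>\<close> part.\<close>
    then have T_eq: "T a b c = 1 + fps_X *
        (fps_const \<alpha> * (T (i + 2) (j + 1) k + T i (j + 2) (k + 1) + T (i + 1) j (k + 2)) +
         fps_const \<beta> * (T (i + 2) j (k + 1) + T i (j + 1) (k + 2) + T (i + 1) (j + 2) k))"
      using sum_eq by (simp add: s_def algebra_simps flip: fps_const_add)
    show ?thesis
    proof (cases n)
      case 0
      then show ?thesis
        using arg_cong[OF T_eq, of "\<lambda>f. f $ 0"] inside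
        by (simp add: walk_gf_nth walk_weight_0 flip: T_def)
    next
      case (Suc m)
      have IH: "walk_weight (triangle_step_weight \<alpha> \<beta>) Omega2 orthant UNIV
          (int x - 1, int y - 1, int z - 1) m = T x y z $ m" if "x + y + z = K" for x y z
        using less.IH[of m x y z] that Suc by (simp add: walk_gf_nth T_def)
      have "walk_gf \<alpha> \<beta> (int a - 1, int b - 1, int c - 1) $ n =
          \<alpha> * (T (i + 2) (j + 1) k $ m + T i (j + 2) (k + 1) $ m + T (i + 1) j (k + 2) $ m) +
          \<beta> * (T (i + 2) j (k + 1) $ m + T i (j + 1) (k + 2) $ m + T (i + 1) (j + 2) k $ m)"
        using inside
        by (simp add: Suc K abc walk_gf_nth walk_weight_Suc finite_Omega2
            sum_Omega2_triangle_step_weight IH[symmetric] add.commute)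
      also have "\<dots> = T a b c $ n"
        by (subst T_eq) (simp add: Suc)
      finally show ?thesis
        by (simp only: T_def)
    qed
  qed
qed

theorem theorem3:
  fixes \<alpha> \<beta> :: "'a::field_char_0" and u v w :: nat and s p :: "'a fps"
  assumes s_eq: "s = fps_const (\<alpha> + \<beta>) * fps_X"
    and p_eq: "p = s * (motzkin_series oo s)"
  shows "walk_gf \<alpha> \<beta> (int u, int v, int w) =
           ((1 - p ^ 3) * (1 - p ^ (u + 1)) * (1 - p ^ (v + 1)) * (1 - p ^ (w + 1))) /
           ((1 - p) ^ 3 * (1 - p ^ (u + v + w + 3)))
         \<and> (motzkin_series :: 'a fps) = motzkin_gf"
proof (intro conjI motzkin_series_eq_gf)
  define N where "N = motzkin_series oo s"
  have s0: "s $ 0 = 0"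
    by (simp add: s_eq)
  have "N = (1 + fps_X * motzkin_series + fps_X\<^sup>2 * motzkin_series\<^sup>2) oo s"
    unfolding N_def by (subst motzkin_series_functional_eq) simp
  also have "\<dots> = 1 + s * N + s\<^sup>2 * N\<^sup>2"
    using s0 by (simp add: N_def fps_compose_add_distrib fps_compose_mult_distrib
        fps_compose_power[symmetric] fps_X_fps_compose_startby0)
  \<comment> \<open>The equation for \<open>N\<close> multiplied by \<open>s\<close>, with
    \<open>p = s * N\<close>.\<close>
  finally have p: "s * (1 + p + p\<^sup>2) = p"
    unfolding p_eq N_def[symmetric] by algebra
  have p0: "p $ 0 = 0"
    by (simp add: p_eq s0)
  define K where "K = u + v + w + 3"
  define D where "D = (1 - p) ^ 3 * (1 - p ^ K)"
  define C where "C = (1 - p ^ 3) * inverse D"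
  \<comment> \<open>\<open>K\<close> is at least 3, so \<open>p ^ K\<close> has zero constant
    coefficient and \<open>D\<close> is a unit.\<close>
  have D0: "D $ 0 \<noteq> 0"
    using p0 by (simp add: D_def K_def fps_mult_nth_0 fps_power_zeroth power_0_left)
  \<comment> \<open>Explains the choice of \<open>C\<close>: since
    \<open>s * (1 + p + p\<^sup>2) = p\<close>, the factor \<open>1 + p + p\<^sup>2\<close> of
    \<open>1 - p ^ 3\<close> turns \<open>1 - 3 * s\<close> into
    \<open>(1 - p)\<^sup>2\<close>.\<close>
  have "(1 - p ^ 3) * (1 - 3 * s) = (1 - p) * (1 + p + p\<^sup>2 - 3 * (s * (1 + p + p\<^sup>2)))"
    by (simp add: algebra_simps power2_eq_square power3_eq_cube)
  also have "\<dots> = (1 - p) ^ 3"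
    unfolding p by (simp add: algebra_simps power2_eq_square power3_eq_cube)
  finally have "(1 - p ^ 3) * ((1 - 3 * s) * (1 - p ^ K)) = D"
    by (simp add: D_def flip: mult.assoc)
  then have "C * ((1 - 3 * s) * (1 - p ^ K)) = D * inverse D"
    unfolding C_def by (simp only: mult_ac)
  then have C: "C * ((1 - 3 * s) * (1 - p ^ K)) = 1"
    using D0 by (simp add: inverse_mult_eq_1')
  have "walk_gf \<alpha> \<beta> (int u, int v, int w) = C * triangle_product p (u + 1) (v + 1) (w + 1)"
  proof (rule fps_ext)
    fix n
    show "walk_gf \<alpha> \<beta> (int u, int v, int w) $ n =
        (C * triangle_product p (u + 1) (v + 1) (w + 1)) $ n"
      using walk_gf_nth_eq_triangle_product[OF p[unfolded s_eq] C[unfolded s_eq],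
          of "u + 1" "v + 1" "w + 1" n]
      by (simp add: K_def)
  qed
  also have "\<dots> = ((1 - p ^ 3) * (1 - p ^ (u + 1)) * (1 - p ^ (v + 1)) * (1 - p ^ (w + 1))) / D"
    using D0 by (simp add: C_def triangle_product_def fps_divide_unit mult_ac)
  finally show "walk_gf \<alpha> \<beta> (int u, int v, int w) =
      ((1 - p ^ 3) * (1 - p ^ (u + 1)) * (1 - p ^ (v + 1)) * (1 - p ^ (w + 1))) /
      ((1 - p) ^ 3 * (1 - p ^ (u + v + w + 3)))"
    unfolding D_def K_def .
qed

end
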